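(* Consider a (differentiable in time) solution of the semi-discrete Lagrangian HTC scheme described in the context, with $|\mathbf A_c(0)|=1$ for every cell $c$. Then the scheme preserves the determinant constraint $|\mathbf A_c|=\rho_c(t)/\rho_c(0)$ exactly on the semi-discrete level, in the sense that for every cell $c$ and every time $t$ $$\frac{d|\mathbf A_c|}{dt}=\frac{d}{dt}\left(\frac{\rho_c}{\rho_c(0)}\right)=-\frac{\rho_c^2}{\rho_c(0)}\frac{d\tau_c}{dt}=-\frac{|\mathbf A_c|}{|\omega_c|}\sum_{p\in\mathcal P(c)}l_{pc}\mathbf n_{pc}\cdot(\mathbf v_p-\mathbf v_c),$$ where $|\mathbf A_c|$ denotes the determinant of $\mathbf A_c$.
   Context: **Mesh.** $\Omega(t)\subset\mathbb R^2$ is covered by a conforming mesh of non-overlapping non-degenerate triangles $\omega_c(t)$ of area $|\omega_c|$, with fixed connectivity and moving nodes. $\mathcal P(c)$ is the set of vertices of $\omega_c$, $\mathcal C(p)$ the set of cells sharing node $p$. For $p\in\mathcal P(c)$, with $(p,p^-,p^+)$ the vertices of $\omega_c$ in counter-clockwise order and $\mathbf x_p=(x_p,y_p)$, the corner normal is $l_{pc}\mathbf n_{pc}=\frac12(y_{p^-}-y_{p^+},\,x_{p^+}-x_{p^-},\,0)$, where $\mathbf n_{pc}=(n_{pc}^k)_k$ is a unit vector and $l_{pc}>0$; hence $\sum_{p\in\mathcal P(c)}l_{pc}\mathbf n_{pc}=\mathbf 0$. The sub-cell $\omega_{pc}$ is the quadrilateral with vertices $\mathbf x_p$, the barycenter of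 $\omega_c$ and the midpoints of the two edges of $\omega_c$ at $p$; $\omega_p=\bigcup_{c\in\mathcal C(p)}\omega_{pc}$ is the dual cell, of area $|\omega_p|$. Nodes move by $\frac{d\mathbf x_p}{dt}=\mathbf v_p$ (planar components). Fields depend on the two planar coordinates; vectors have three components and tensors are $3\times3$, planar vectors being padded with a zero third component. **State and energy.** Each cell carries specific volume $\tau_c=1/\rho_c>0$, velocity $\mathbf v_c$, specific entropy $S_c$, distortion $\mathbf A_c$, thermal impulse $\mathbf J_c$. The mass $m_c=\rho_c|\omega_c|$ is constant in time. The specific total energy is $E=E_1(\tau,S)+\frac12|\mathbf v|^2+\frac14c_s^2\,\mathring G_{ij}\mathring G_{ij}+\frac12c_h^2|\mathbf J|^2$, with $E_1$ a given smooth convex function, $\mathbf G=\mathbf A^T\mathbf A$, $\mathring G_{ij}=G_{ij}-\frac13G_{mm}\delta_{ij}$ and constants $c_s,c_h$. Dual variables: $p=-\partial E/\partial\tau$, $T=\partial E/\partial S$ (assumed $>0$), $\boldsymbol\Gamma=\partial E/\partial\mathbf A$, $\boldsymbol\beta=\partial E/\partial\mathbf J$; stress $\boldsymbol\sigma=\rho\mathbf A^T\boldsymbol\Gamma+\rho\,\mathbf J\otimes\boldsymbol\beta$. A subscript $c$ means evaluation at the state of cell $c$. $\theta_1=\theta_1(\tau_1)>0$, $\theta_2=\theta_2(\tau_2)>0$ are given functions of relaxation times $\tau_1,\tau_2>0$. **Scheme** (summation over repeated component indices $i,j,k,l$): $$m_c\frac{d\tau_c}{dt}-\sum_{p\in\mathcal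 P(c)}l_{pc}\mathbf n_{pc}\cdot(\mathbf v_p-\mathbf v_c)=0,$$ $$m_c\frac{d v_c^i}{dt}+\sum_{p\in\mathcal P(c)}\Big(l_{pc}n_{pc}^i(p_p-p_c)+l_{pc}n_{pc}^k(\sigma_p^{ik}-\sigma_c^{ik})\Big)+\sum_{p\in\mathcal P(c)}l_{pc}(\alpha_p+\epsilon_p)(v_c^i-v_p^i)=0,$$ $$m_c\frac{dS_c}{dt}+\sum_{p\in\mathcal P(c)}l_{pc}\mathbf n_{pc}\cdot(\rho_p\boldsymbol\beta_p-\rho_c\boldsymbol\beta_c)=\Pi_c+\pi_c,$$ $$m_c\frac{dA_c^{ik}}{dt}+\rho_cA_c^{il}\sum_{p\in\mathcal P(c)}l_{pc}n_{pc}^k(v_p^l-v_c^l)=-\frac1{\theta_1}\Gamma_c^{ik},$$ $$m_c\frac{dJ_c^i}{dt}+\rho_cJ_c^l\sum_{p\in\mathcal P(c)}l_{pc}n_{pc}^i(v_p^l-v_c^l)+\rho_c\sum_{p\in\mathcal P(c)}l_{pc}n_{pc}^i(T_p-T_c)+\rho_c\sum_{p\in\mathcal P(c)}l_{pc}n_{pc}^i(\alpha_p+\epsilon_p)D_p=-\frac1{\theta_2}\beta_c^i,$$ where $D_p=\sum_{c\in\mathcal C(p)}l_{pc}\mathbf n_{pc}\cdot\rho_c\boldsymbol\beta_c$ (up to sign, the volume-integrated discrete divergence of $\rho\boldsymbol\beta$ on the dual cell), $\epsilon_p\ge0$ is a given numerical viscosity, and each nodal value is the average $q_p=\big(\sum_{c\in\mathcal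 C(p)}l_{pc}q_c\big)/\sum_{c\in\mathcal C(p)}l_{pc}$ for $q\in\{\mathbf v,p,\rho,T,\boldsymbol\sigma,\boldsymbol\beta\}$. Entropy production: $\pi_c=\frac{\boldsymbol\Gamma_c:\boldsymbol\Gamma_c}{T_c\theta_1}+\frac{\boldsymbol\beta_c\cdot\boldsymbol\beta_c}{T_c\theta_2}$ and $\Pi_c=\sum_{p\in\mathcal P(c)}\frac{|\omega_{pc}|}{|\omega_p|}\frac{\Pi_p}{T_c}$ with $\Pi_p=\epsilon_p\delta_p$, $\delta_p=\sum_{c\in\mathcal C(p)}l_{pc}|\mathbf v_c-\mathbf v_p|^2+D_p^2$. The correction factor is $\alpha_p=\nu_p/\delta_p$ if $\delta_p\ne0$ and $\alpha_p=0$ if $\delta_p=0$, with $$\nu_p=\sum_{c\in\mathcal C(p)}l_{pc}n_{pc}^k\Big(p_cv_c^k-p_cv_p^k-p_pv_c^k+\sigma_c^{ik}v_c^i-\sigma_c^{ik}v_p^i-\sigma_p^{ik}v_c^i+T_c\rho_c\beta_c^k-T_c\rho_p\beta_p^k-T_p\rho_c\beta_c^k\Big).$$ *)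

theory Defs
  imports "HOL-Analysis.Analysis"
begin

text \<open>\<open>Ck_on k U f\<close>: \<open>f\<close> is of class \<open>C\<^sup>k\<close> on the open set \<open>U\<close>.\<close>

primrec Ck_on :: "nat \<Rightarrow> 'a::euclidean_space set \<Rightarrow> ('a \<Rightarrow> real) \<Rightarrow> bool" where
  "Ck_on 0 U f \<longleftrightarrow> continuous_on U f"
| "Ck_on (Suc k) U f \<longleftrightarrow>
     (\<forall>x\<in>U. f differentiable (at x)) \<and> (\<forall>v. Ck_on k U (\<lambda>x. frechet_derivative f (at x) v))"

definition smooth_on :: "'a::euclidean_space set \<Rightarrow> ('a \<Rightarrow> real) \<Rightarrow> bool" where
  "smooth_on U f \<longleftrightarrow> (\<forall>k. Ck_on k U f)"

text \<open>
  The data that are fixed in time. The connectivity is given by the finite set of cells and the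
  vertex set of each cell; the orientation is recovered from the node positions. The numerical
  viscosity is an arbitrary given nonnegative function of time and node.
\<close>

record ('c, 'p) htc_model =
  cells :: "'c set"
  verts :: "'c \<Rightarrow> 'p set"
  E1 :: "real \<Rightarrow> real \<Rightarrow> real"
  cs :: real
  ch :: real
  theta1 :: "real \<Rightarrow> real"
  theta2 :: "real \<Rightarrow> real"
  relax1 :: real
  relax2 :: real
  visc :: "real \<Rightarrow> 'p \<Rightarrow> real"

text \<open>The unknowns at one instant; a solution is a curve \<open>real \<Rightarrow> ('c, 'p) htc_state\<close>.\<close>

record ('c, 'p) htc_state =
  node_pos :: "'p \<Rightarrow> real^2"
  tau :: "'c \<Rightarrow> real"
  vel :: "'c \<Rightarrow> real^3"
  entr :: "'c \<Rightarrow> real"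
  distortion :: "'c \<Rightarrow> real^3^3"
  impulse :: "'c \<Rightarrow> real^3"

definition admissible_model :: "('c, 'p) htc_model \<Rightarrow> bool" where
  "admissible_model M \<longleftrightarrow>
     finite (cells M) \<and> (\<forall>c\<in>cells M. card (verts M c) = 3) \<and>
     smooth_on ({0<..} \<times> UNIV) (\<lambda>(x, s). E1 M x s) \<and>
     convex_on ({0<..} \<times> UNIV) (\<lambda>(x, s). E1 M x s) \<and>
     relax1 M > 0 \<and> relax2 M > 0 \<and>
     (\<forall>r>0. theta1 M r > 0) \<and> (\<forall>r>0. theta2 M r > 0) \<and>
     (\<forall>t p. visc M t p \<ge> 0)"


subsection \<open>Mesh geometry\<close>

definition nodes :: "('c, 'p) htc_model \<Rightarrow> 'p set" where
  "nodes M = (\<Union>c\<in>cells M. verts M c)"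

definition cells_at :: "('c, 'p) htc_model \<Rightarrow> 'p \<Rightarrow> 'c set" where
  "cells_at M p = {c \<in> cells M. p \<in> verts M c}"

definition triangle :: "('c, 'p) htc_model \<Rightarrow> ('c, 'p) htc_state \<Rightarrow> 'c \<Rightarrow> (real^2) set" where
  "triangle M u c = convex hull (node_pos u ` verts M c)"

text \<open>The domain covered by the mesh is the union of its triangles.\<close>

definition conforming_mesh :: "('c, 'p) htc_model \<Rightarrow> ('c, 'p) htc_state \<Rightarrow> bool" where
  "conforming_mesh M u \<longleftrightarrow>
     (\<forall>c\<in>cells M. \<not> collinear (node_pos u ` verts M c)) \<and>
     (\<forall>c\<in>cells M. \<forall>d\<in>cells M. c \<noteq> d \<longrightarrow>
        interior (triangle M u c) \<inter> interior (triangle M u d) = {} \<and>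
        triangle M u c \<inter> triangle M u d = convex hull (node_pos u ` (verts M c \<inter> verts M d)))"

definition area :: "('c, 'p) htc_model \<Rightarrow> ('c, 'p) htc_state \<Rightarrow> 'c \<Rightarrow> real" where
  "area M u c = measure lebesgue (triangle M u c)"

definition ccw :: "real^2 \<Rightarrow> real^2 \<Rightarrow> real^2 \<Rightarrow> bool" where
  "ccw a b c \<longleftrightarrow> (b$1 - a$1) * (c$2 - a$2) - (b$2 - a$2) * (c$1 - a$1) > 0"

text \<open>
  The pair \<open>(p\<^sup>-, p\<^sup>+)\<close>, where \<open>(p, p\<^sup>-, p\<^sup>+)\<close> is the counter-clockwise enumeration of the
  vertices of the cell. With this order the corner normal points out of the cell.
\<close>

definition neighbours ::
  "('c, 'p) htc_model \<Rightarrow> ('c, 'p) htc_state \<Rightarrow> 'c \<Rightarrow> 'p \<Rightarrow> 'p \<times> 'p" where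
  "neighbours M u c p = (THE (q, r).
     verts M c = {p, q, r} \<and> ccw (node_pos u p) (node_pos u q) (node_pos u r))"

definition corner_vector ::
  "('c, 'p) htc_model \<Rightarrow> ('c, 'p) htc_state \<Rightarrow> 'p \<Rightarrow> 'c \<Rightarrow> real^3" where
  "corner_vector M u p c = (case neighbours M u c p of (q, r) \<Rightarrow>
     (1/2) *\<^sub>R vector [node_pos u q $ 2 - node_pos u r $ 2, node_pos u r $ 1 - node_pos u q $ 1, 0])"

definition corner_len :: "('c, 'p) htc_model \<Rightarrow> ('c, 'p) htc_state \<Rightarrow> 'p \<Rightarrow> 'c \<Rightarrow> real" where
  "corner_len M u p c = norm (corner_vector M u p c)"

definition corner_normal :: "('c, 'p) htc_model \<Rightarrow> ('c, 'p) htc_state \<Rightarrow> 'p \<Rightarrow> 'c \<Rightarrow> real^3" where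
  "corner_normal M u p c = corner_vector M u p c /\<^sub>R corner_len M u p c"

text \<open>The sub-cell is a convex quadrilateral, hence the convex hull of its four vertices.\<close>

definition subcell ::
  "('c, 'p) htc_model \<Rightarrow> ('c, 'p) htc_state \<Rightarrow> 'p \<Rightarrow> 'c \<Rightarrow> (real^2) set" where
  "subcell M u p c = convex hull
     (insert (node_pos u p)
       (insert ((1/3) *\<^sub>R (\<Sum>q\<in>verts M c. node_pos u q))
         ((\<lambda>q. midpoint (node_pos u p) (node_pos u q)) ` (verts M c - {p}))))"

definition dual_cell ::
  "('c, 'p) htc_model \<Rightarrow> ('c, 'p) htc_state \<Rightarrow> 'p \<Rightarrow> (real^2) set" where
  "dual_cell M u p = (\<Union>c\<in>cells_at M p. subcell M u p c)"


subsection \<open>Energy and dual variables\<close>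

definition dev_metric :: "real^3^3 \<Rightarrow> real^3^3" where
  "dev_metric A = (let G = transpose A ** A in G - mat (trace G / 3))"

definition energy ::
  "('c, 'p) htc_model \<Rightarrow> real \<Rightarrow> real^3 \<Rightarrow> real \<Rightarrow> real^3^3 \<Rightarrow> real^3 \<Rightarrow> real" where
  "energy M x v s A J = E1 M x s + (1/2) * (norm v)\<^sup>2
     + (1/4) * (cs M)\<^sup>2 * (\<Sum>i\<in>UNIV. \<Sum>j\<in>UNIV. dev_metric A $ i $ j * dev_metric A $ i $ j)
     + (1/2) * (ch M)\<^sup>2 * (norm J)\<^sup>2"

definition rho :: "('c, 'p) htc_state \<Rightarrow> 'c \<Rightarrow> real" where
  "rho u c = 1 / tau u c"

definition pressure :: "('c, 'p) htc_model \<Rightarrow> ('c, 'p) htc_state \<Rightarrow> 'c \<Rightarrow> real" where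
  "pressure M u c =
     - deriv (\<lambda>x. energy M x (vel u c) (entr u c) (distortion u c) (impulse u c)) (tau u c)"

definition temperature :: "('c, 'p) htc_model \<Rightarrow> ('c, 'p) htc_state \<Rightarrow> 'c \<Rightarrow> real" where
  "temperature M u c =
     deriv (\<lambda>s. energy M (tau u c) (vel u c) s (distortion u c) (impulse u c)) (entr u c)"

text \<open>Componentwise partial derivatives; \<open>axis i (axis k 1)\<close> is the matrix unit at \<open>(i, k)\<close>.\<close>

definition Gam :: "('c, 'p) htc_model \<Rightarrow> ('c, 'p) htc_state \<Rightarrow> 'c \<Rightarrow> real^3^3" where
  "Gam M u c = (\<chi> i k. deriv (\<lambda>h. energy M (tau u c) (vel u c) (entr u c)
     (distortion u c + h *\<^sub>R axis i (axis k 1)) (impulse u c)) 0)"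

definition beta :: "('c, 'p) htc_model \<Rightarrow> ('c, 'p) htc_state \<Rightarrow> 'c \<Rightarrow> real^3" where
  "beta M u c = (\<chi> i. deriv (\<lambda>h. energy M (tau u c) (vel u c) (entr u c)
     (distortion u c) (impulse u c + h *\<^sub>R axis i 1)) 0)"

definition stress :: "('c, 'p) htc_model \<Rightarrow> ('c, 'p) htc_state \<Rightarrow> 'c \<Rightarrow> real^3^3" where
  "stress M u c = rho u c *\<^sub>R (transpose (distortion u c) ** Gam M u c)
     + rho u c *\<^sub>R (\<chi> i k. impulse u c $ i * beta M u c $ k)"


subsection \<open>Nodal quantities\<close>

definition avg ::
  "('c, 'p) htc_model \<Rightarrow> ('c, 'p) htc_state \<Rightarrow> ('c \<Rightarrow> 'a::real_vector) \<Rightarrow> 'p \<Rightarrow> 'a" where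
  "avg M u q p = (\<Sum>c\<in>cells_at M p. corner_len M u p c *\<^sub>R q c) /\<^sub>R (\<Sum>c\<in>cells_at M p. corner_len M u p c)"

definition nodal_D :: "('c, 'p) htc_model \<Rightarrow> ('c, 'p) htc_state \<Rightarrow> 'p \<Rightarrow> real" where
  "nodal_D M u p = (\<Sum>c\<in>cells_at M p. corner_len M u p c * (corner_normal M u p c \<bullet> (rho u c *\<^sub>R beta M u c)))"

definition delta :: "('c, 'p) htc_model \<Rightarrow> ('c, 'p) htc_state \<Rightarrow> 'p \<Rightarrow> real" where
  "delta M u p =
     (\<Sum>c\<in>cells_at M p. corner_len M u p c * (norm (vel u c - avg M u (vel u) p))\<^sup>2) + (nodal_D M u p)\<^sup>2"

definition nu :: "('c, 'p) htc_model \<Rightarrow> ('c, 'p) htc_state \<Rightarrow> 'p \<Rightarrow> real" where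
  "nu M u p =
     (let vp = avg M u (vel u) p; pp = avg M u (pressure M u) p; rp = avg M u (rho u) p;
          Tp = avg M u (temperature M u) p; sp = avg M u (stress M u) p; bp = avg M u (beta M u) p
      in \<Sum>c\<in>cells_at M p.
        let vc = vel u c; pc = pressure M u c; rc = rho u c;
            Tc = temperature M u c; sc = stress M u c; bc = beta M u c
        in \<Sum>k\<in>UNIV. corner_len M u p c * corner_normal M u p c $ k *
             (pc * vc $ k - pc * vp $ k - pp * vc $ k
              + (\<Sum>i\<in>UNIV. sc $ i $ k * vc $ i - sc $ i $ k * vp $ i - sp $ i $ k * vc $ i)
              + Tc * rc * bc $ k - Tc * rp * bp $ k - Tp * rc * bc $ k))"

definition alpha :: "('c, 'p) htc_model \<Rightarrow> ('c, 'p) htc_state \<Rightarrow> 'p \<Rightarrow> real" where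
  "alpha M u p = (if delta M u p \<noteq> 0 then nu M u p / delta M u p else 0)"


subsection \<open>Entropy production\<close>

definition prod_relax :: "('c, 'p) htc_model \<Rightarrow> ('c, 'p) htc_state \<Rightarrow> 'c \<Rightarrow> real" where
  "prod_relax M u c =
     (\<Sum>i\<in>UNIV. \<Sum>k\<in>UNIV. Gam M u c $ i $ k * Gam M u c $ i $ k)
        / (temperature M u c * theta1 M (relax1 M))
     + (beta M u c \<bullet> beta M u c) / (temperature M u c * theta2 M (relax2 M))"

definition prod_visc :: "('c, 'p) htc_model \<Rightarrow> real \<Rightarrow> ('c, 'p) htc_state \<Rightarrow> 'c \<Rightarrow> real" where
  "prod_visc M t u c =
     (\<Sum>p\<in>verts M c. measure lebesgue (subcell M u p c) / measure lebesgue (dual_cell M u p)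
        * ((visc M t p * delta M u p) / temperature M u c))"


subsection \<open>The semi-discrete scheme\<close>

definition mass :: "('c, 'p) htc_model \<Rightarrow> ('c, 'p) htc_state \<Rightarrow> 'c \<Rightarrow> real" where
  "mass M u c = rho u c * area M u c"

text \<open>
  The time derivative relative to the time interval \<open>I\<close>, i.e. one-sided at an end point of \<open>I\<close>.
\<close>

abbreviation ddt :: "real set \<Rightarrow> (real \<Rightarrow> 'a::real_normed_vector) \<Rightarrow> real \<Rightarrow> 'a" where
  "ddt I f t \<equiv> vector_derivative f (at t within I)"

definition time_interval :: "real set \<Rightarrow> bool" where
  "time_interval I \<longleftrightarrow> is_interval I \<and> I \<subseteq> {0..} \<and> 0 \<in> I \<and> I \<noteq> {0}"

definition node_motion ::
  "('c, 'p) htc_model \<Rightarrow> real set \<Rightarrow> (real \<Rightarrow> ('c, 'p) htc_state) \<Rightarrow> real \<Rightarrow> bool" where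
  "node_motion M I U t \<longleftrightarrow> (\<forall>p\<in>nodes M.
     ddt I (\<lambda>s. node_pos (U s) p) t =
       vector [avg M (U t) (vel (U t)) p $ 1, avg M (U t) (vel (U t)) p $ 2])"

definition volume_eq ::
  "('c, 'p) htc_model \<Rightarrow> real set \<Rightarrow> (real \<Rightarrow> ('c, 'p) htc_state) \<Rightarrow> real \<Rightarrow> 'c \<Rightarrow> bool" where
  "volume_eq M I U t c \<longleftrightarrow> (let u = U t in
     mass M u c * ddt I (\<lambda>s. tau (U s) c) t
     - (\<Sum>p\<in>verts M c. corner_len M u p c * (corner_normal M u p c \<bullet> (avg M u (vel u) p - vel u c))) = 0)"

definition momentum_eq ::
  "('c, 'p) htc_model \<Rightarrow> real set \<Rightarrow> (real \<Rightarrow> ('c, 'p) htc_state) \<Rightarrow> real \<Rightarrow> 'c \<Rightarrow> bool" where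
  "momentum_eq M I U t c \<longleftrightarrow> (let u = U t in \<forall>i.
     mass M u c * ddt I (\<lambda>s. vel (U s) c) t $ i
     + (\<Sum>p\<in>verts M c.
          corner_len M u p c * corner_normal M u p c $ i * (avg M u (pressure M u) p - pressure M u c)
          + (\<Sum>k\<in>UNIV. corner_len M u p c * corner_normal M u p c $ k *
               (avg M u (stress M u) p $ i $ k - stress M u c $ i $ k)))
     + (\<Sum>p\<in>verts M c. corner_len M u p c * (alpha M u p + visc M t p) *
          (vel u c $ i - avg M u (vel u) p $ i)) = 0)"

definition entropy_eq ::
  "('c, 'p) htc_model \<Rightarrow> real set \<Rightarrow> (real \<Rightarrow> ('c, 'p) htc_state) \<Rightarrow> real \<Rightarrow> 'c \<Rightarrow> bool" where
  "entropy_eq M I U t c \<longleftrightarrow> (let u = U t in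
     mass M u c * ddt I (\<lambda>s. entr (U s) c) t
     + (\<Sum>p\<in>verts M c. corner_len M u p c *
          (corner_normal M u p c \<bullet> (avg M u (rho u) p *\<^sub>R avg M u (beta M u) p - rho u c *\<^sub>R beta M u c)))
     = prod_visc M t u c + prod_relax M u c)"

definition distortion_eq ::
  "('c, 'p) htc_model \<Rightarrow> real set \<Rightarrow> (real \<Rightarrow> ('c, 'p) htc_state) \<Rightarrow> real \<Rightarrow> 'c \<Rightarrow> bool" where
  "distortion_eq M I U t c \<longleftrightarrow> (let u = U t in \<forall>i k.
     mass M u c * ddt I (\<lambda>s. distortion (U s) c) t $ i $ k
     + rho u c * (\<Sum>j\<in>UNIV. distortion u c $ i $ j *
          (\<Sum>p\<in>verts M c. corner_len M u p c * corner_normal M u p c $ k * (avg M u (vel u) p $ j - vel u c $ j)))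
     = - (1 / theta1 M (relax1 M)) * Gam M u c $ i $ k)"

definition impulse_eq ::
  "('c, 'p) htc_model \<Rightarrow> real set \<Rightarrow> (real \<Rightarrow> ('c, 'p) htc_state) \<Rightarrow> real \<Rightarrow> 'c \<Rightarrow> bool" where
  "impulse_eq M I U t c \<longleftrightarrow> (let u = U t in \<forall>i.
     mass M u c * ddt I (\<lambda>s. impulse (U s) c) t $ i
     + rho u c * (\<Sum>j\<in>UNIV. impulse u c $ j *
          (\<Sum>p\<in>verts M c. corner_len M u p c * corner_normal M u p c $ i * (avg M u (vel u) p $ j - vel u c $ j)))
     + rho u c * (\<Sum>p\<in>verts M c. corner_len M u p c * corner_normal M u p c $ i *
          (avg M u (temperature M u) p - temperature M u c))
     + rho u c * (\<Sum>p\<in>verts M c. corner_len M u p c * corner_normal M u p c $ i *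
          (alpha M u p + visc M t p) * nodal_D M u p)
     = - (1 / theta2 M (relax2 M)) * beta M u c $ i)"

definition htc_solution ::
  "('c, 'p) htc_model \<Rightarrow> real set \<Rightarrow> (real \<Rightarrow> ('c, 'p) htc_state) \<Rightarrow> bool" where
  "htc_solution M I U \<longleftrightarrow> (\<forall>t\<in>I.
     conforming_mesh M (U t) \<and>
     (\<forall>p\<in>nodes M. (\<lambda>s. node_pos (U s) p) differentiable (at t within I)) \<and>
     node_motion M I U t \<and>
     (\<forall>c\<in>cells M.
        tau (U t) c > 0 \<and> temperature M (U t) c > 0 \<and> mass M (U t) c = mass M (U 0) c \<and>
        (\<lambda>s. tau (U s) c) differentiable (at t within I) \<and>
        (\<lambda>s. vel (U s) c) differentiable (at t within I) \<and>
        (\<lambda>s. entr (U s) c) differentiable (at t within I) \<and>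
        (\<lambda>s. distortion (U s) c) differentiable (at t within I) \<and>
        (\<lambda>s. impulse (U s) c) differentiable (at t within I) \<and>
        volume_eq M I U t c \<and> momentum_eq M I U t c \<and> entropy_eq M I U t c \<and>
        distortion_eq M I U t c \<and> impulse_eq M I U t c))"

end

theory Submission
  imports Defs
begin

text \<open>
  Since \<open>\<Gamma> = c\<^sub>s\<^sup>2 A dev(G)\<close>, the distortion equation has the form \<open>dA/dt = A X\<close>, and the trace-free
  relaxation term does not contribute to \<open>trace X\<close>. Jacobi's formula and the volume equation then
  give \<open>d(det A)/dt = - \<rho> (d\<tau>/dt) det A\<close>, so \<open>\<tau> det A\<close> is constant in time.
\<close>

text \<open>Jacobi's formula for a derivative of the form \<open>A X\<close>. Once the 3x3
  determinant is expanded it is a polynomial identity in the entries, so no inverse of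
  \<open>A\<close> enters.\<close>

lemma has_real_derivative_det_3:
  fixes A :: "real \<Rightarrow> real^3^3"
  assumes "(A has_vector_derivative A t ** X) (at t within I)"
  shows "((\<lambda>s. det (A s)) has_real_derivative det (A t) * trace X) (at t within I)"
proof -
  have comp: "((\<lambda>s. A s $ i $ j) has_real_derivative (A t ** X) $ i $ j) (at t within I)" for i j
    unfolding has_real_derivative_iff_has_vector_derivative
    by (intro bounded_linear.has_vector_derivative[OF bounded_linear_vec_nth] assms)
  show ?thesis
    unfolding det_3
    by (rule derivative_eq_intros comp refl)+
      (simp add: matrix_matrix_mult_def trace_def sum_3 algebra_simps)
qed

lemma trace_dev_metric: "trace (dev_metric A) = 0"
  by (simp add: dev_metric_def Let_def trace_def mat_def sum_3 field_simps)

text \<open>Let \<open>E\<close> be the matrix unit at \<open>(i, k)\<close>. To first order the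
  metric changes by \<open>B = E^T A + A^T E\<close>. Since \<open>F = dev(G)\<close> is trace-free
  and symmetric, the derivative is \<open>2 F : dev B = 2 F : B = 4 (A F)_ik\<close>.\<close>

lemma sum_dev_metric_sq_has_derivative:
  fixes A :: "real^3^3" and i k :: 3
  defines "f \<equiv> (\<lambda>h. dev_metric (A + h *\<^sub>R axis i (axis k 1)))"
  shows "((\<lambda>h. \<Sum>j\<in>UNIV. \<Sum>l\<in>UNIV. f h $ j $ l * f h $ j $ l)
           has_real_derivative 4 * (A ** dev_metric A) $ i $ k) (at 0)"
proof -
  let ?G = "transpose A ** A"
  define B :: "real^3^3" where
    "B = (\<chi> j l. (if j = k then A $ i $ l else 0) + (if l = k then A $ i $ j else 0))"
  define C :: "real^3^3" where "C = axis k (axis k 1)"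
  define dev :: "real^3^3 \<Rightarrow> real^3^3" where "dev = (\<lambda>G. G - mat (trace G / 3))"
  define F where "F = dev ?G"
  \<comment> \<open>The metric is exactly quadratic in \<open>h\<close>, with second-order
    coefficient \<open>E^T E = C\<close>.\<close>
  have G: "transpose (A + h *\<^sub>R axis i (axis k 1)) ** (A + h *\<^sub>R axis i (axis k 1))
      = ?G + h *\<^sub>R B + h\<^sup>2 *\<^sub>R C" for h
    using exhaust_3[of i] exhaust_3[of k]
    by (auto simp: vec_eq_iff matrix_matrix_mult_def transpose_def B_def C_def sum_3 axis_def
        forall_3 algebra_simps power2_eq_square)
  have f: "f h $ j $ l = F $ j $ l + h * dev B $ j $ l + h\<^sup>2 * dev C $ j $ l" for h j l
    unfolding f_def dev_metric_def Let_def G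
    by (simp add: F_def dev_def trace_add mat_def trace_def sum_3 algebra_simps add_divide_distrib)
  have D: "dev_metric A = F"
    by (simp add: dev_metric_def F_def dev_def Let_def)
  have sym: "F $ j $ l = F $ l $ j" for j l
    by (auto simp: F_def dev_def mat_def matrix_matrix_mult_def transpose_def mult.commute)
  \<comment> \<open>The zero trace is solved for one diagonal entry, so that substituting it cancels
    the trace part of \<open>dev B\<close>.\<close>
  have tr: "F $ 3 $ 3 = - F $ 1 $ 1 - F $ 2 $ 2"
    using trace_dev_metric[of A] by (simp add: D trace_def sum_3)
  have devB: "dev B $ j $ l = B $ j $ l - (if j = l then trace B / 3 else 0)" for j l
    by (simp add: dev_def mat_def)
  have "((\<lambda>h. \<Sum>j\<in>UNIV. \<Sum>l\<in>UNIV. f h $ j $ l * f h $ j $ l) has_real_derivative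
     (\<Sum>j\<in>UNIV. \<Sum>l\<in>UNIV. 2 * F $ j $ l * dev B $ j $ l)) (at 0)"
    unfolding f by (intro DERIV_sum) (auto intro!: derivative_eq_intros)
  also have "(\<Sum>j\<in>UNIV. \<Sum>l\<in>UNIV. 2 * F $ j $ l * dev B $ j $ l)
      = (\<Sum>j\<in>UNIV. \<Sum>l\<in>UNIV. 2 * F $ j $ l * B $ j $ l)"
    by (simp add: devB sum_3 tr algebra_simps)
  also have "\<dots> = 4 * (A ** F) $ i $ k"
    using exhaust_3[of k]
    by (auto simp: B_def matrix_matrix_mult_def sum_3 sym[where j=2 and l=1] sym[where j=3 and l=1] sym[where j=3 and l=2])
  finally show ?thesis unfolding D .
qed

text \<open>Only the shear energy depends on the distortion, and its factor 1/4 cancels the 4 of the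
  preceding derivative.\<close>

lemma Gam_eq: "Gam M u c = (cs M)\<^sup>2 *\<^sub>R (distortion u c ** dev_metric (distortion u c))"
proof -
  have "Gam M u c $ i $ k = (cs M)\<^sup>2 * (distortion u c ** dev_metric (distortion u c)) $ i $ k" for i k
    unfolding Gam_def energy_def vec_lambda_beta
    by (rule DERIV_imp_deriv)
      (rule derivative_eq_intros sum_dev_metric_sq_has_derivative refl | simp)+
  then show ?thesis by (simp add: vec_eq_iff)
qed

text \<open>Three non-collinear points of the plane are affinely independent, so their hull has
  interior points and is not a null set. Positive mass follows, which allows dividing the scheme by
  it.\<close>

lemma area_pos:
  assumes "conforming_mesh M u" "card (verts M c) = 3" "c \<in> cells M"
  shows "area M u c > 0"
proof -
  let ?S = "node_pos u ` verts M c"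
  have nc: "\<not> collinear ?S"
    using assms by (simp add: conforming_mesh_def)
  have fin: "finite ?S"
    using assms(2) by (metis card.infinite finite_imageI zero_neq_numeral)
  have "card ?S \<le> 3"
    using assms(2) card_image_le[of "verts M c" "node_pos u"] by (metis card.infinite zero_neq_numeral)
  \<comment> \<open>If two vertices shared a position, at most two points would remain, and these
    are always collinear.\<close>
  moreover have "\<not> card ?S \<le> 2"
    using nc collinear_small[OF fin] by blast
  ultimately have card: "card ?S = 3" by simp
  then obtain a b d where S: "?S = {a, b, d}" 
    by (auto simp: card_3_iff)
  have "\<not> affine_dependent ?S"
    using nc affine_dependent_imp_collinear_3 unfolding S by blast
  then have int: "interior (convex hull ?S) \<noteq> {}"
    using interior_convex_hull_eq_empty[of ?S] card by simp
  have "convex hull ?S \<in> lmeasurable"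
    using fin by (simp add: bounded_convex_hull finite_imp_bounded measurable_convex)
  moreover have "\<not> negligible (convex hull ?S)"
    using int negligible_convex_interior[of "convex hull ?S"] by simp
  ultimately have "measure lebesgue (convex hull ?S) \<noteq> 0"
    using negligible_iff_measure by blast
  then show ?thesis
    by (simp add: area_def triangle_def less_le)
qed

text \<open>Both the transport term and \<open>Gam\<close> carry \<open>A\<close> as a left factor,
  so division by the mass yields \<open>A X\<close>. The relaxation part of \<open>X\<close> is
  trace-free, which leaves only the velocity gradient in the trace.\<close>

lemma distortion_vector_derivative:
  assumes "distortion_eq M I U t c" "mass M (U t) c \<noteq> 0"
  defines "u \<equiv> U t"
  defines "L \<equiv> \<Sum>p\<in>verts M c. corner_len M u p c * (corner_normal M u p c \<bullet> (avg M u (vel u) p - vel u c))"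
  shows "\<exists>X. ddt I (\<lambda>s. distortion (U s) c) t = distortion u c ** X
           \<and> trace X = - (rho u c / mass M u c) * L"
proof -
  \<comment> \<open>\<open>W\<close> is the discrete velocity gradient integrated over the cell; its
    trace is the discrete divergence \<open>L\<close> of the volume equation.\<close>
  define W :: "real^3^3" where "W = (\<chi> j k. \<Sum>p\<in>verts M c.
      corner_len M u p c * corner_normal M u p c $ k * (avg M u (vel u) p $ j - vel u c $ j))"
  let ?A = "distortion u c" and ?m = "mass M u c"
  define r where "r = (cs M)\<^sup>2 / theta1 M (relax1 M)"
  define X where "X = (- 1 / ?m) *\<^sub>R (rho u c *\<^sub>R W + r *\<^sub>R dev_metric ?A)"
  have m: "?m \<noteq> 0" using assms by simp
  have trW: "trace W = L"
    by (simp add: trace_def W_def L_def inner_vec_def sum_distrib_left mult.assoc)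
      (rule sum.swap)
  have "trace X = (- 1 / ?m) * (rho u c * trace W + r * trace (dev_metric ?A))"
    by (simp add: X_def trace_def sum_3 algebra_simps)
  then have "trace X = - (rho u c / ?m) * L"
    by (simp add: trW trace_dev_metric)
  moreover have "ddt I (\<lambda>s. distortion (U s) c) t $ i $ k = (?A ** X) $ i $ k" for i k
  proof -
    have "?m * ddt I (\<lambda>s. distortion (U s) c) t $ i $ k + rho u c * (?A ** W) $ i $ k
        = - (1 / theta1 M (relax1 M)) * Gam M u c $ i $ k"
      using assms(1)
      by (simp add: distortion_eq_def Let_def u_def[symmetric] W_def matrix_matrix_mult_def)
    then have "?m * ddt I (\<lambda>s. distortion (U s) c) t $ i $ k
       = - rho u c * (?A ** W) $ i $ k - r * (?A ** dev_metric ?A) $ i $ k"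
      by (simp add: Gam_eq r_def)
    also have "\<dots> = ?m * (?A ** X) $ i $ k"
      using m by (simp add: X_def matrix_matrix_mult_def sum_3 field_simps)
    finally show ?thesis using m by simp
  qed
  ultimately show ?thesis by (auto simp: vec_eq_iff)
qed

text \<open>The differentiability conjuncts give the derivative equalities their content, because
  \<open>vector_derivative\<close> is a choice term with an unspecified value where no derivative
  exists.\<close>

theorem theorem3p3:
  fixes M :: "('c, 'p) htc_model"
    and I :: "real set"
    and U :: "real \<Rightarrow> ('c, 'p) htc_state"
    and c :: 'c
    and t :: real
  assumes "admissible_model M"
    and "time_interval I"
    and "htc_solution M I U"
    and "\<forall>d\<in>cells M. det (distortion (U 0) d) = 1"
    and "c \<in> cells M"
    and "t \<in> I"
  shows "det (distortion (U t) c) = rho (U t) c / rho (U 0) c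
    \<and> (\<lambda>s. det (distortion (U s) c)) differentiable (at t within I)
    \<and> (\<lambda>s. rho (U s) c / rho (U 0) c) differentiable (at t within I)
    \<and> ddt I (\<lambda>s. det (distortion (U s) c)) t = ddt I (\<lambda>s. rho (U s) c / rho (U 0) c) t
    \<and> ddt I (\<lambda>s. rho (U s) c / rho (U 0) c) t
        = - ((rho (U t) c)\<^sup>2 / rho (U 0) c) * ddt I (\<lambda>s. tau (U s) c) t
    \<and> - ((rho (U t) c)\<^sup>2 / rho (U 0) c) * ddt I (\<lambda>s. tau (U s) c) t
        = - (det (distortion (U t) c) / area M (U t) c) *
            (\<Sum>p\<in>verts M c. corner_len M (U t) p c *
               (corner_normal M (U t) p c \<bullet> (avg M (U t) (vel (U t)) p - vel (U t) c)))"
proof -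
  let ?\<tau> = "\<lambda>s. tau (U s) c" and ?d = "\<lambda>s. det (distortion (U s) c)"
  let ?L = "\<lambda>s. \<Sum>p\<in>verts M c. corner_len M (U s) p c *
    (corner_normal M (U s) p c \<bullet> (avg M (U s) (vel (U s)) p - vel (U s) c))"
  have I: "is_interval I" "0 \<in> I" "I \<noteq> {0}"
    using assms(2) by (auto simp: time_interval_def)
  have sol: "conforming_mesh M (U s)" "?\<tau> s > 0" "?\<tau> differentiable (at s within I)"
    "(\<lambda>s. distortion (U s) c) differentiable (at s within I)"
    "volume_eq M I U s c" "distortion_eq M I U s c" if "s \<in> I" for s
    using assms(3,5) that by (auto simp: htc_solution_def)
  have area: "area M (U s) c > 0" if "s \<in> I" for s
    using area_pos[OF sol(1)[OF that]] assms(1,5) by (auto simp: admissible_model_def)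
  have mass: "mass M (U s) c = area M (U s) c / ?\<tau> s" "mass M (U s) c > 0" if "s \<in> I" for s
    using area[OF that] sol(2)[OF that] by (auto simp: mass_def rho_def)
  have L: "?L s = mass M (U s) c * ddt I ?\<tau> s" if "s \<in> I" for s
    using sol(5)[OF that] by (simp add: volume_eq_def Let_def)
  have tau': "(?\<tau> has_real_derivative ddt I ?\<tau> s) (at s within I)" if "s \<in> I" for s
    using sol(3)[OF that] vector_derivative_works
    by (auto simp: has_real_derivative_iff_has_vector_derivative)
  have det': "(?d has_real_derivative - ?d s * ddt I ?\<tau> s / ?\<tau> s) (at s within I)" if s: "s \<in> I" for s
  proof -
    obtain X where X: "ddt I (\<lambda>s. distortion (U s) c) s = distortion (U s) c ** X"
      "trace X = - (rho (U s) c / mass M (U s) c) * ?L s"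
      using distortion_vector_derivative[OF sol(6)[OF s]] mass(2)[OF s] by auto
    \<comment> \<open>The volume equation replaces \<open>L\<close> by mass times the derivative of
      \<open>tau\<close>, and the mass cancels.\<close>
    have "trace X = - ddt I ?\<tau> s / ?\<tau> s"
      unfolding X(2) L[OF s] using mass(2)[OF s] by (simp add: rho_def)
    moreover have "(?d has_real_derivative ?d s * trace X) (at s within I)"
      using sol(4)[OF s] by (intro has_real_derivative_det_3) (simp add: X(1)[symmetric] vector_derivative_works)
    ultimately show ?thesis by simp
  qed
  \<comment> \<open>Product rule: the logarithmic derivatives of the determinant and of
    \<open>tau\<close> are opposite.\<close>
  have "((\<lambda>s. ?d s * ?\<tau> s) has_real_derivative 0) (at s within I)" if s: "s \<in> I" for s
    using sol(2)[OF s] by (auto intro!: derivative_eq_intros det'[OF s] tau'[OF s])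
  then obtain k where k: "\<And>s. s \<in> I \<Longrightarrow> ?d s * ?\<tau> s = k"
    using has_field_derivative_zero_constant[of I "\<lambda>s. ?d s * ?\<tau> s"] I(1)
    by (auto simp: is_interval_convex_1)
  \<comment> \<open>At time 0 the determinant is 1, so the constant \<open>k\<close> is the initial
    specific volume.\<close>
  have det: "?d s = rho (U s) c / rho (U 0) c" if s: "s \<in> I" for s
    using k[OF s] k[OF I(2)] assms(4,5) sol(2)[OF s] by (simp add: rho_def field_simps)
  have rho': "((\<lambda>s. rho (U s) c / rho (U 0) c) has_real_derivative
      - ((rho (U t) c)\<^sup>2 / rho (U 0) c) * ddt I ?\<tau> t) (at t within I)"
    unfolding rho_def using sol(2)[OF assms(6)] sol(2)[OF I(2)]
    by (auto intro!: derivative_eq_intros tau'[OF assms(6)] simp: field_simps power2_eq_square)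
  \<comment> \<open>A nondegenerate interval has no isolated points, so derivatives within
    \<open>I\<close> are unique, also at its end points.\<close>
  have "t islimpt I"
    using I assms(6) by (intro connected_imp_perfect) (auto simp: is_interval_connected_1)
  then have bot: "at t within I \<noteq> bot"
    by (simp add: trivial_limit_within)
  have drho: "ddt I (\<lambda>s. rho (U s) c / rho (U 0) c) t
      = - ((rho (U t) c)\<^sup>2 / rho (U 0) c) * ddt I ?\<tau> t"
    using rho' bot
    by (intro vector_derivative_within) (auto simp: has_real_derivative_iff_has_vector_derivative)
  have "ddt I ?d t = - ?d t * ddt I ?\<tau> t / ?\<tau> t"
    using det'[OF assms(6)] bot
    by (intro vector_derivative_within) (auto simp: has_real_derivative_iff_has_vector_derivative)
  then have ddet: "ddt I ?d t = - ((rho (U t) c)\<^sup>2 / rho (U 0) c) * ddt I ?\<tau> t"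
    by (simp add: det[OF assms(6)] rho_def power2_eq_square)
  have "- ((rho (U t) c)\<^sup>2 / rho (U 0) c) * ddt I ?\<tau> t = - (?d t / area M (U t) c) * ?L t"
    using area[OF assms(6)] unfolding L[OF assms(6)] det[OF assms(6)]
    by (simp add: mass_def power2_eq_square)
  then show ?thesis
    using det[OF assms(6)] ddet drho det'[OF assms(6)] rho'
    by (auto simp: has_field_derivative_def intro: differentiableI)
qed

end
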